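(* Let $\mathbb{P}$ and $\mathbb{Q}$ be probability measures on a filtered space $(\Omega,\mathscr{F},(\mathscr{F}_t))$ and let $(Z_t)$ be a càdlàg, adapted, non-negative process such that $\mathbb{Q}|_{\mathscr{F}_t}=Z_t\,\mathbb{P}|_{\mathscr{F}_t}$ for every $t$. Let $\Upsilon=\inf\{t\ge 0: Z_t=0\}$ and $Z_\infty=\limsup_{t\to\infty}Z_t$. Then for any $t\in[0,\infty)$, \[\mathbb{P}(\Upsilon>t)=\mathbb{P}(Z_t>0)=\mathbb{E}_{\mathbb{Q}}[1/Z_t];\] also \[\mathbb{P}(Z_\infty>0)=\mathbb{E}_{\mathbb{Q}}[1/Z_\infty].\]
   Context: Time may be continuous ($t\in\mathbb{R}_+$) or discrete ($t\in\mathbb{Z}_+$; then the càdlàg requirement is void and $t$ ranges over $\mathbb{Z}_+$). The relation $\mathbb{Q}|_{\mathscr{F}_t}=Z_t\,\mathbb{P}|_{\mathscr{F}_t}$ means $\mathbb{Q}(A)=\mathbb{E}_{\mathbb{P}}[Z_t\mathbf{1}_A]$ for all $A\in\mathscr{F}_t$; here $Z$ takes values in $[0,\infty)$. $\mathbb{E}_{\mathbb{P}},\mathbb{E}_{\mathbb{Q}}$ denote expectations under $\mathbb{P},\mathbb{Q}$. $\Upsilon$ is called the extinction time, with $\inf\emptyset=\infty$. $Z_\infty$ takes values in $[0,\infty]$, and $1/\infty=0$. For each $t$ the event $\{Z_t=0\}$ is $\mathbb{Q}$-null, as is $\{Z_\infty=0\}$, so $1/Z_t$ and $1/Z_\infty$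 are defined $\mathbb{Q}$-almost surely (their values on these null events are irrelevant under $\mathbb{Q}$). *)

theory Defs
  imports "HOL-Probability.Probability"
begin

text \<open>
  Continuous and discrete time are treated at once by a set \<open>T\<close> of real times, which is either
  \<open>{0..}\<close> or \<open>\<nat>\<close>. Families indexed by time are total functions on the reals, but only their
  values at times in \<open>T\<close> are ever constrained or used.
\<close>

definition filtration_on :: "'a measure \<Rightarrow> real set \<Rightarrow> (real \<Rightarrow> 'a measure) \<Rightarrow> bool" where
  "filtration_on M T F \<longleftrightarrow>
     (\<forall>t\<in>T. subalgebra M (F t)) \<and> (\<forall>s\<in>T. \<forall>t\<in>T. s \<le> t \<longrightarrow> sets (F s) \<subseteq> sets (F t))"

definition adapted_on :: "real set \<Rightarrow> (real \<Rightarrow> 'a measure) \<Rightarrow> (real \<Rightarrow> 'a \<Rightarrow> real) \<Rightarrow> bool" where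
  "adapted_on T F Z \<longleftrightarrow> (\<forall>t\<in>T. Z t \<in> borel_measurable (F t))"

text \<open>
  One-sided limits are taken along \<open>T\<close>. If \<open>t\<close> is not an accumulation point of \<open>T\<close> from the
  given side, the filter is trivial and the condition is void; see the two lemmas below.
\<close>

definition cadlag_on :: "real set \<Rightarrow> (real \<Rightarrow> real) \<Rightarrow> bool" where
  "cadlag_on T f \<longleftrightarrow>
     (\<forall>t\<in>T. (f \<longlongrightarrow> f t) (at t within T \<inter> {t<..}) \<and>
            (\<exists>l. (f \<longlongrightarrow> l) (at t within T \<inter> {..<t})))"

lemma cadlag_on_Nats: "cadlag_on \<nat> f"
proof -
  have "at t within (\<nat> \<inter> S) = bot" for t :: real and S
  proof -
    have "x = y" if "x \<in> \<nat>" "y \<in> \<nat>" "dist y x < 1" for x y :: real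
      using that by (auto elim!: Nats_cases simp: dist_real_def)
    then have "\<not> t islimpt \<nat>"
      by (metis discrete_imp_not_islimpt zero_less_one)
    then have "\<not> t islimpt (\<nat> \<inter> S)"
      by (meson inf_le1 islimpt_subset)
    then show ?thesis
      by (simp add: trivial_limit_within)
  qed
  then show ?thesis
    by (simp add: cadlag_on_def)
qed

lemma cadlag_on_atLeast:
  "cadlag_on {0..} f \<longleftrightarrow>
     (\<forall>t\<ge>0. (f \<longlongrightarrow> f t) (at_right t)) \<and> (\<forall>t>0. \<exists>l. (f \<longlongrightarrow> l) (at_left t))"
proof -
  have right: "{0..} \<inter> {t<..} = {t<..}" if "t \<ge> 0" for t :: real
    using that by auto
  have left: "at t within {0..} \<inter> {..<t} = at_left t" if "t > 0" for t :: real
    by (rule at_within_nhd[where S = "{0<..}"]) (use that in auto)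
  have zero: "{0..} \<inter> {..<0::real} = {}"
    by auto
  have "(\<exists>l. (f \<longlongrightarrow> l) (at t within {0..} \<inter> {..<t})) \<longleftrightarrow> (t > 0 \<longrightarrow> (\<exists>l. (f \<longlongrightarrow> l) (at_left t)))"
    if "t \<ge> 0" for t :: real
    using that left zero by (cases "t = 0") auto
  then show ?thesis
    by (auto simp: cadlag_on_def right)
qed

definition density_process ::
  "'a measure \<Rightarrow> 'a measure \<Rightarrow> real set \<Rightarrow> (real \<Rightarrow> 'a measure) \<Rightarrow> (real \<Rightarrow> 'a \<Rightarrow> real) \<Rightarrow> bool" where
  "density_process P Q T F Z \<longleftrightarrow>
     (\<forall>t\<in>T. \<forall>A\<in>sets (F t). emeasure Q A = (\<integral>\<^sup>+\<omega>. ennreal (Z t \<omega>) * indicator A \<omega> \<partial>P))"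

definition extinction_time :: "real set \<Rightarrow> (real \<Rightarrow> 'a \<Rightarrow> real) \<Rightarrow> 'a \<Rightarrow> ereal" where
  "extinction_time T Z \<omega> = Inf (ereal ` {t \<in> T. Z t \<omega> = 0})"

definition limsup_process :: "real set \<Rightarrow> (real \<Rightarrow> 'a \<Rightarrow> real) \<Rightarrow> 'a \<Rightarrow> ennreal" where
  "limsup_process T Z \<omega> = Limsup (inf at_top (principal T)) (\<lambda>t. ennreal (Z t \<omega>))"

text \<open>
  In continuous time the event that the extinction time exceeds \<open>t\<close> is the complement of the
  projection of a set in \<open>[0,t] \<times> \<Omega>\<close>; without a completeness assumption on the
  probability space it need not be measurable, so probabilities of such events are to be read in
  the completion of the measure, which agrees with the measure itself on measurable sets.
\<close>

end

theory Submission
  imports Defs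
begin

text \<open>
  On \<open>F t\<close> the measure \<open>Q\<close> has density \<open>Z t\<close> with respect to \<open>P\<close>, so integrating \<open>1 / Z t\<close>
  against \<open>Q\<close> integrates \<open>Z t * (1 / Z t)\<close>, the indicator of \<open>Z t > 0\<close>, against \<open>P\<close>
  (\<open>expectation_inverse_density\<close>). Everything else rests on one comparison: on a set of \<open>F t\<close> where
  \<open>Z t < b\<close> one has \<open>Q \<le> b * P\<close>, and where \<open>Z t \<ge> a\<close> one has \<open>a * P \<le> Q\<close>. Decomposing according to
  the first passage time (\<open>emeasure_le_hitting\<close>) or looking at the last time (\<open>emeasure_le_avoiding\<close>)
  transports such a comparison to events that involve countably many times. Right-continuity of the
  paths lets the rational times stand for all times.

  \<^bold>\<open>Extinction.\<close> If \<open>Z\<close> vanishes before \<open>t\<close>, then it falls below every \<open>\<epsilon> > 0\<close> at a rational time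
  before \<open>t\<close>, an event of \<open>Q\<close>-measure at most \<open>\<epsilon>\<close> by first passage. The event that this happens for
  all \<open>\<epsilon>\<close> is thus \<open>Q\<close>-null; it lies in \<open>F t\<close>, so \<open>Z t\<close> vanishes \<open>P\<close>-almost everywhere on it. Hence
  the events that the extinction time exceeds \<open>t\<close> and that \<open>Z t > 0\<close> differ by a subset of a
  \<open>P\<close>-null set.

  \<^bold>\<open>The limit superior.\<close> The same comparison replaces martingale convergence. On the event
  that \<open>Z\<close> is eventually below \<open>b\<close> and returns to \<open>[a, \<infinity>)\<close> at arbitrarily late times, the limit
  superior \<open>L\<close> lies in \<open>[a, b]\<close>; and \<open>a * P \<le> Q \<le> b * P\<close> on it, by first passage and by looking at
  the last time (\<open>scaled_le_Q_band\<close>, \<open>Q_le_scaled_band\<close>). So the \<open>Q\<close>-integral of \<open>1 / L\<close> over this event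
  agrees with its \<open>P\<close>-measure up to a factor \<open>b / a\<close>. The bands with \<open>a = r\<^sup>k\<close>, \<open>b = r\<^sup>k\<^sup>+\<^sup>1\<close> for
  integer \<open>k\<close> partition \<open>0 < L < \<infinity>\<close>; summing over them and letting \<open>r\<close> decrease to \<open>1\<close> gives
  equality there. Finally \<open>L = 0\<close> is \<open>Q\<close>-null, \<open>L = \<infinity>\<close> is \<open>P\<close>-null, and \<open>1 / L\<close> vanishes on the
  latter.
\<close>

section \<open>Comparison of measures and monotone limits\<close>

lemma emeasure_le_UN_incseq:
  fixes A :: "nat \<Rightarrow> 'a set"
  assumes "range A \<subseteq> sets M" "sets N = sets M" "incseq A"
    and "\<And>i. emeasure M (A i) \<le> emeasure N (A i)"
  shows "emeasure M (\<Union>i. A i) \<le> emeasure N (\<Union>i. A i)"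
  using assms by (auto simp flip: SUP_emeasure_incseq intro!: SUP_mono)

lemma emeasure_le_INT_decseq:
  fixes A :: "nat \<Rightarrow> 'a set"
  assumes "finite_measure M" "finite_measure N" "range A \<subseteq> sets M" "sets N = sets M" "decseq A"
    and "\<And>i. emeasure M (A i) \<le> emeasure N (A i)"
  shows "emeasure M (\<Inter>i. A i) \<le> emeasure N (\<Inter>i. A i)"
proof -
  have "(INF i. emeasure M (A i)) \<le> (INF i. emeasure N (A i))"
    using assms(6) by (intro INF_mono) auto
  then show ?thesis
    using assms by (simp add: INF_emeasure_decseq finite_measure.emeasure_finite)
qed

lemma countable_exhaustion_by_finite:
  assumes "countable J" "finite K\<^sub>0" "K\<^sub>0 \<subseteq> J"
  obtains K :: "nat \<Rightarrow> 'b set"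
  where "\<And>i. finite (K i)" "\<And>i. K\<^sub>0 \<subseteq> K i" "\<And>i. K i \<subseteq> J" "incseq K" "(\<Union>i. K i) = J"
proof
  let ?K = "\<lambda>i. K\<^sub>0 \<union> {x \<in> J. to_nat_on J x \<le> i}"
  show "finite (?K i)" for i
  proof -
    have "finite {x \<in> J. to_nat_on J x \<le> i}"
    proof (rule finite_imageD)
      show "finite (to_nat_on J ` {x \<in> J. to_nat_on J x \<le> i})"
        by (rule finite_subset[of _ "{..i}"]) auto
      show "inj_on (to_nat_on J) {x \<in> J. to_nat_on J x \<le> i}"
        using inj_on_to_nat_on[OF assms(1)] by (rule inj_on_subset) auto
    qed
    then show ?thesis
      using assms by simp
  qed
  show "incseq ?K"
    by (auto simp: incseq_def)
  show "(\<Union>i. ?K i) = J"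
    using assms(3) by auto
qed (use assms(3) in auto)

text \<open>
  The next two lemmas reduce a comparison over countably many times to finitely many, where a
  first or a last time exists. The set \<open>K\<^sub>0\<close> in the second one is for forcing a chosen late
  time to belong to every finite set that is tested.
\<close>

lemma emeasure_le_UN_finite_subsets:
  assumes "countable J" and X: "\<And>t. t \<in> J \<Longrightarrow> X t \<in> sets M" and A: "A \<in> sets M"
    and sets: "sets N = sets M"
    and le: "\<And>K. finite K \<Longrightarrow> K \<subseteq> J \<Longrightarrow>
               emeasure M (A \<inter> (\<Union>t\<in>K. X t)) \<le> emeasure N (A \<inter> (\<Union>t\<in>K. X t))"
  shows "emeasure M (A \<inter> (\<Union>t\<in>J. X t)) \<le> emeasure N (A \<inter> (\<Union>t\<in>J. X t))"
proof -
  obtain K where K: "\<And>i. finite (K i)" "\<And>i. K i \<subseteq> J" "incseq K" "(\<Union>i. K i) = J"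
    using countable_exhaustion_by_finite[of J "{}"] \<open>countable J\<close> by auto
  have "(\<Union>i. A \<inter> (\<Union>t\<in>K i. X t)) = A \<inter> (\<Union>t\<in>J. X t)"
    unfolding K(4)[symmetric] by blast
  moreover have "emeasure M (\<Union>i. A \<inter> (\<Union>t\<in>K i. X t)) \<le> emeasure N (\<Union>i. A \<inter> (\<Union>t\<in>K i. X t))"
  proof (rule emeasure_le_UN_incseq)
    have "(\<Union>t\<in>K i. X t) \<in> sets M" for i
      using K(1,2) X by (intro sets.finite_UN) auto
    then show "range (\<lambda>i. A \<inter> (\<Union>t\<in>K i. X t)) \<subseteq> sets M"
      using A by auto
    show "incseq (\<lambda>i. A \<inter> (\<Union>t\<in>K i. X t))"
      using K(3) unfolding incseq_def by blast
    show "emeasure M (A \<inter> (\<Union>t\<in>K i. X t)) \<le> emeasure N (A \<inter> (\<Union>t\<in>K i. X t))" for i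
      using K(1,2) by (rule le)
  qed (rule sets)
  ultimately show ?thesis
    by simp
qed

lemma emeasure_le_INT_finite_subsets:
  assumes fin: "finite_measure M" "finite_measure N"
    and "countable J" and X: "\<And>t. t \<in> J \<Longrightarrow> X t \<in> sets M" and A: "A \<in> sets M"
    and sets: "sets N = sets M" and "finite K\<^sub>0" "K\<^sub>0 \<subseteq> J"
    and le: "\<And>K. finite K \<Longrightarrow> K\<^sub>0 \<subseteq> K \<Longrightarrow> K \<subseteq> J \<Longrightarrow>
               emeasure M (A \<inter> (\<Inter>t\<in>K. X t)) \<le> emeasure N (A \<inter> (\<Inter>t\<in>K. X t))"
  shows "emeasure M (A \<inter> (\<Inter>t\<in>J. X t)) \<le> emeasure N (A \<inter> (\<Inter>t\<in>J. X t))"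
proof -
  obtain K where K: "\<And>i. finite (K i)" "\<And>i. K\<^sub>0 \<subseteq> K i" "\<And>i. K i \<subseteq> J" "incseq K" "(\<Union>i. K i) = J"
    using countable_exhaustion_by_finite[of J K\<^sub>0] assms by metis
  have "(\<Inter>i. A \<inter> (\<Inter>t\<in>K i. X t)) = A \<inter> (\<Inter>t\<in>J. X t)"
    unfolding K(5)[symmetric] by blast
  moreover have "emeasure M (\<Inter>i. A \<inter> (\<Inter>t\<in>K i. X t)) \<le> emeasure N (\<Inter>i. A \<inter> (\<Inter>t\<in>K i. X t))"
  proof (rule emeasure_le_INT_decseq[OF fin])
    have "A \<inter> (\<Inter>t\<in>K i. X t) \<in> sets M" for i
    proof (cases "K i = {}")
      case False
      then have "(\<Inter>t\<in>K i. X t) \<in> sets M"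
        using K(1,3)[of i] X by (intro sets.finite_INT) auto
      then show ?thesis
        using A by auto
    qed (use A in simp)
    then show "range (\<lambda>i. A \<inter> (\<Inter>t\<in>K i. X t)) \<subseteq> sets M"
      by auto
    show "decseq (\<lambda>i. A \<inter> (\<Inter>t\<in>K i. X t))"
      using K(4) unfolding incseq_def decseq_def by blast
    show "emeasure M (A \<inter> (\<Inter>t\<in>K i. X t)) \<le> emeasure N (A \<inter> (\<Inter>t\<in>K i. X t))" for i
      using K(1-3) by (rule le)
  qed (rule sets)
  ultimately show ?thesis
    by simp
qed

lemma emeasure_le_UN_disjoint:
  assumes "countable I" "disjoint_family_on K I" "\<And>i. i \<in> I \<Longrightarrow> K i \<in> sets M" "sets N = sets M"
    and "\<And>i. i \<in> I \<Longrightarrow> emeasure M (K i) \<le> emeasure N (K i)"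
  shows "emeasure M (\<Union>i\<in>I. K i) \<le> emeasure N (\<Union>i\<in>I. K i)"
proof -
  have "emeasure M (\<Union>i\<in>I. K i) = (\<integral>\<^sup>+i. emeasure M (K i) \<partial>count_space I)"
    using assms by (intro emeasure_UN_countable) auto
  also have "\<dots> \<le> (\<integral>\<^sup>+i. emeasure N (K i) \<partial>count_space I)"
    using assms(5) by (intro nn_integral_mono) auto
  also have "\<dots> = emeasure N (\<Union>i\<in>I. K i)"
    using assms by (intro emeasure_UN_countable[symmetric]) auto
  finally show ?thesis .
qed

lemma ennreal_eq_0_if_le_inverse_Suc:
  fixes x :: ennreal
  assumes "\<And>k. x \<le> ennreal (1 / real (Suc k))"
  shows "x = 0"
proof -
  have "(\<lambda>k. ennreal (1 / real (Suc k))) \<longlonglongrightarrow> ennreal 0"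
    using LIMSEQ_inverse_real_of_nat by (intro tendsto_ennrealI) (simp add: inverse_eq_divide)
  then have "x \<le> ennreal 0"
    using assms by (intro tendsto_lowerbound[where F = sequentially]) auto
  then show ?thesis
    by simp
qed

lemma finite_measure_scale_measure:
  assumes "finite_measure M"
  shows "finite_measure (scale_measure (ennreal c) M)"
  using finite_measure.emeasure_finite[OF assms]
  by (intro finite_measureI) (auto simp: ennreal_mult_eq_top_iff)

section \<open>First-passage and last-time arguments\<close>

text \<open>
  The set where some \<open>X t\<close> occurs is split according to the first \<open>t\<close> at which it occurs; each piece
  belongs to \<open>F t\<close> and is contained in \<open>X t\<close>, so the hypothesis on single times applies. All times in
  \<open>J\<close> must be at least \<open>s\<close>, so that intersecting a piece with \<open>A\<close> leaves it in \<open>F t\<close>.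
\<close>

lemma emeasure_le_hitting:
  fixes F :: "real \<Rightarrow> 'a measure" and J :: "real set"
  assumes filt: "filtration_on M T F" and sets: "sets N = sets M"
    and X: "\<And>t. t \<in> T \<Longrightarrow> X t \<in> sets (F t)"
    and le: "\<And>t B. t \<in> T \<Longrightarrow> B \<in> sets (F t) \<Longrightarrow> B \<subseteq> X t \<Longrightarrow> emeasure M B \<le> emeasure N B"
    and A: "s \<in> T" "A \<in> sets (F s)" and J: "countable J" "J \<subseteq> T \<inter> {s..}"
  shows "emeasure M (A \<inter> (\<Union>t\<in>J. X t)) \<le> emeasure N (A \<inter> (\<Union>t\<in>J. X t))"
proof -
  have sub: "sets (F t) \<subseteq> sets M" if "t \<in> T" for t
    using filt that by (auto simp: filtration_on_def subalgebra_def)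
  have mono: "B \<in> sets (F u)" if "B \<in> sets (F t)" "t \<in> T" "u \<in> T" "t \<le> u" for B t u
    using filt that by (auto simp: filtration_on_def)
  show ?thesis
  proof (rule emeasure_le_UN_finite_subsets)
    fix K assume "finite K" "K \<subseteq> J"
    then have "K \<subseteq> T \<inter> {s..}"
      using J by auto
    with \<open>finite K\<close> show "emeasure M (A \<inter> (\<Union>t\<in>K. X t)) \<le> emeasure N (A \<inter> (\<Union>t\<in>K. X t))"
    proof (induction rule: finite_linorder_max_induct)
      case (insert u K)
      \<comment> \<open>Since \<open>u\<close> is larger than all of \<open>K\<close>, the new piece consists of the first passages at \<open>u\<close>.\<close>
      let ?old = "A \<inter> (\<Union>t\<in>K. X t)" and ?new = "(A \<inter> X u) - (\<Union>t\<in>K. X t)"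
      have split: "A \<inter> (\<Union>t\<in>insert u K. X t) = ?old \<union> ?new" "?old \<inter> ?new = {}"
        by auto
      have "(\<Union>t\<in>K. X t) \<in> sets (F u)"
        using insert by (intro sets.finite_UN mono[OF X]) (auto simp: less_imp_le)
      moreover have "A \<in> sets (F u)"
        using insert A by (intro mono[OF A(2)]) auto
      ultimately have F: "?old \<in> sets (F u)" "?new \<in> sets (F u)"
        using X insert by auto
      then have M: "?old \<in> sets M" "?new \<in> sets M"
        using sub insert by blast+
      have "emeasure M ?old + emeasure M ?new \<le> emeasure N ?old + emeasure N ?new"
      proof (rule add_mono)
        show "emeasure M ?old \<le> emeasure N ?old"
          using insert.IH insert.prems by auto
        show "emeasure M ?new \<le> emeasure N ?new"
          using insert.prems F by (intro le[of u]) auto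
      qed
      then show ?case
        using M sets split by (simp add: plus_emeasure)
    qed simp
  next
    show "X t \<in> sets M" if "t \<in> J" for t
      using that J sub[of t] X[of t] by blast
    show "A \<in> sets M"
      using sub A by blast
  qed (rule J(1), rule sets)
qed

text \<open>
  For finitely many times, the intersection is an event of \<open>F w\<close> contained in \<open>X w\<close>, where \<open>w\<close> is the
  largest of them. The time \<open>u\<close> ensures \<open>s \<le> w\<close>, hence also that \<open>A\<close> belongs to \<open>F w\<close>.
\<close>

lemma emeasure_le_avoiding:
  fixes F :: "real \<Rightarrow> 'a measure" and J :: "real set"
  assumes fin: "finite_measure M" "finite_measure N"
    and filt: "filtration_on M T F" and sets: "sets N = sets M"
    and X: "\<And>t. t \<in> T \<Longrightarrow> X t \<in> sets (F t)"
    and le: "\<And>t B. t \<in> T \<Longrightarrow> B \<in> sets (F t) \<Longrightarrow> B \<subseteq> X t \<Longrightarrow> emeasure M B \<le> emeasure N B"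
    and A: "s \<in> T" "A \<in> sets (F s)" and J: "countable J" "J \<subseteq> T" "u \<in> J" "s \<le> u"
  shows "emeasure M (A \<inter> (\<Inter>t\<in>J. X t)) \<le> emeasure N (A \<inter> (\<Inter>t\<in>J. X t))"
proof -
  have sub: "sets (F t) \<subseteq> sets M" if "t \<in> T" for t
    using filt that by (auto simp: filtration_on_def subalgebra_def)
  have mono: "B \<in> sets (F u)" if "B \<in> sets (F t)" "t \<in> T" "u \<in> T" "t \<le> u" for B t u
    using filt that by (auto simp: filtration_on_def)
  show ?thesis
  proof (rule emeasure_le_INT_finite_subsets[where K\<^sub>0="{u}"])
    fix K assume K: "finite K" "{u} \<subseteq> K" "K \<subseteq> J"
    define w where "w = Max K"
    have "w \<in> K" and max: "\<And>t. t \<in> K \<Longrightarrow> t \<le> w"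
      using K by (auto simp: w_def intro!: Max_in)
    then have w: "w \<in> T" "s \<le> w" "K \<subseteq> T"
      using K J by force+
    have "(\<Inter>t\<in>K. X t) \<in> sets (F w)"
      using K w max by (intro sets.finite_INT mono[OF X]) auto
    then have "A \<inter> (\<Inter>t\<in>K. X t) \<in> sets (F w)"
      using mono[OF A(2) A(1) w(1,2)] by auto
    then show "emeasure M (A \<inter> (\<Inter>t\<in>K. X t)) \<le> emeasure N (A \<inter> (\<Inter>t\<in>K. X t))"
      using \<open>w \<in> K\<close> w by (intro le[of w]) auto
  next
    show "X t \<in> sets M" if "t \<in> J" for t
      using that J sub[of t] X[of t] by blast
    show "A \<in> sets M"
      using sub A by blast
    show "{u} \<subseteq> J"
      using J by blast
  qed (rule fin J(1) sets finite.emptyI finite.insertI)+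
qed

section \<open>Densities along a filtration\<close>

locale filtered_density =
  fixes P Q :: "'a measure" and T :: "real set"
    and F :: "real \<Rightarrow> 'a measure" and Z :: "real \<Rightarrow> 'a \<Rightarrow> real"
  assumes time: "T = {0..} \<or> T = \<nat>"
    and prob_P: "prob_space P" and prob_Q: "prob_space Q" and sets_eq: "sets Q = sets P"
    and filtration: "filtration_on P T F"
    and cadlag: "\<And>\<omega>. \<omega> \<in> space P \<Longrightarrow> cadlag_on T (\<lambda>t. Z t \<omega>)"
    and adapted: "adapted_on T F Z"
    and nonneg: "\<And>t \<omega>. t \<in> T \<Longrightarrow> \<omega> \<in> space P \<Longrightarrow> 0 \<le> Z t \<omega>"
    and density: "density_process P Q T F Z"
begin

text \<open>
  In both time models this is a countable set of times that determines right-continuous paths; in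
  discrete time it is all of \<open>T\<close>.
\<close>

definition D :: "real set" where
  "D = T \<inter> \<rat>"

abbreviation L :: "'a \<Rightarrow> ennreal" where
  "L \<equiv> limsup_process T Z"

lemma space_eq: "space Q = space P"
  using sets_eq by (rule sets_eq_imp_space_eq)

lemma finite_P: "finite_measure P" and finite_Q: "finite_measure Q"
  using prob_P prob_Q by (auto simp: prob_space_def)

lemma D_subset: "D \<subseteq> T" and countable_D: "countable D"
  by (auto simp: D_def intro: countable_subset[OF _ countable_rat])

lemma of_nat_in_D [simp]: "real n \<in> D"
  using time by (auto simp: D_def)

lemma of_nat_in_T: "real n \<in> T"
  using D_subset of_nat_in_D by blast

lemma T_nonneg: "t \<in> T \<Longrightarrow> 0 \<le> t"
  using time by (auto elim: Nats_cases)

lemma subalgebra_F: "t \<in> T \<Longrightarrow> subalgebra P (F t)" "t \<in> T \<Longrightarrow> subalgebra Q (F t)"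
  using filtration sets_eq space_eq by (auto simp: filtration_on_def subalgebra_def)

lemma space_F: "t \<in> T \<Longrightarrow> space (F t) = space P"
  and sets_F: "t \<in> T \<Longrightarrow> B \<in> sets (F t) \<Longrightarrow> B \<in> sets P"
  using subalgebra_F by (auto simp: subalgebra_def)

lemma sets_F_mono: "B \<in> sets (F s) \<Longrightarrow> s \<in> T \<Longrightarrow> t \<in> T \<Longrightarrow> s \<le> t \<Longrightarrow> B \<in> sets (F t)"
  using filtration by (auto simp: filtration_on_def)

lemma Z_measurable_F: "t \<in> T \<Longrightarrow> Z t \<in> borel_measurable (F t)"
  using adapted by (auto simp: adapted_on_def)

lemma Z_measurable: "t \<in> T \<Longrightarrow> Z t \<in> borel_measurable P"
  using Z_measurable_F subalgebra_F(1) measurable_from_subalg by blast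

lemma level_sets_F:
  assumes "t \<in> T"
  shows "{\<omega> \<in> space P. Z t \<omega> < b} \<in> sets (F t)" "{\<omega> \<in> space P. b \<le> Z t \<omega>} \<in> sets (F t)"
proof -
  have [measurable]: "Z t \<in> borel_measurable (F t)"
    using assms by (rule Z_measurable_F)
  have "{\<omega> \<in> space (F t). Z t \<omega> < b} \<in> sets (F t)" "{\<omega> \<in> space (F t). b \<le> Z t \<omega>} \<in> sets (F t)"
    by measurable
  then show "{\<omega> \<in> space P. Z t \<omega> < b} \<in> sets (F t)" "{\<omega> \<in> space P. b \<le> Z t \<omega>} \<in> sets (F t)"
    using space_F assms by auto
qed

lemma emeasure_Q_F:
  "t \<in> T \<Longrightarrow> B \<in> sets (F t) \<Longrightarrow> emeasure Q B = (\<integral>\<^sup>+\<omega>. ennreal (Z t \<omega>) * indicator B \<omega> \<partial>P)"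
  using density by (auto simp: density_process_def)

lemma Q_le_scaled:
  assumes "t \<in> T" "B \<in> sets (F t)" "B \<subseteq> {\<omega> \<in> space P. Z t \<omega> < b}"
  shows "emeasure Q B \<le> emeasure (scale_measure (ennreal b) P) B"
proof -
  have "emeasure Q B \<le> (\<integral>\<^sup>+\<omega>. ennreal b * indicator B \<omega> \<partial>P)"
    unfolding emeasure_Q_F[OF assms(1,2)]
    using assms(3) by (intro nn_integral_mono) (auto simp: indicator_def intro!: ennreal_leI)
  also have "\<dots> = ennreal b * emeasure P B"
    using sets_F assms by (simp add: nn_integral_cmult_indicator)
  finally show ?thesis
    by simp
qed

lemma scaled_le_Q:
  assumes "t \<in> T" "B \<in> sets (F t)" "B \<subseteq> {\<omega> \<in> space P. a \<le> Z t \<omega>}"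
  shows "emeasure (scale_measure (ennreal a) P) B \<le> emeasure Q B"
proof -
  have "ennreal a * emeasure P B = (\<integral>\<^sup>+\<omega>. ennreal a * indicator B \<omega> \<partial>P)"
    using sets_F assms by (simp add: nn_integral_cmult_indicator)
  also have "\<dots> \<le> emeasure Q B"
    unfolding emeasure_Q_F[OF assms(1,2)]
    using assms(3) by (intro nn_integral_mono) (auto simp: indicator_def intro!: ennreal_leI)
  finally show ?thesis
    by simp
qed

lemma filtration_Q: "filtration_on Q T F" and filtration_scaled: "filtration_on (scale_measure c P) T F"
  using filtration sets_eq space_eq
  by (auto simp: filtration_on_def subalgebra_def space_scale_measure)

text \<open>
  Since \<open>1 / Z t\<close> is measurable for \<open>F t\<close>, its \<open>Q\<close>-integral can be computed on \<open>F t\<close>, where \<open>Q\<close> has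
  density \<open>Z t\<close>. At \<open>Z t = 0\<close> the integrand \<open>Z t * (1 / Z t)\<close> is \<open>0 * \<infinity> = 0\<close>.
\<close>

lemma expectation_inverse_density:
  assumes "t \<in> T"
  shows "emeasure P {\<omega> \<in> space P. Z t \<omega> > 0} = (\<integral>\<^sup>+\<omega>. 1 / ennreal (Z t \<omega>) \<partial>Q)"
proof -
  note sub = subalgebra_F[OF assms]
  have Zm: "Z t \<in> borel_measurable (F t)"
    using assms by (rule Z_measurable_F)
  have meas: "(\<lambda>\<omega>. 1 / ennreal (Z t \<omega>)) \<in> borel_measurable (F t)"
    using Zm by measurable
  let ?R = "restr_to_subalg P (F t)"
  have ZR: "(\<lambda>\<omega>. ennreal (Z t \<omega>)) \<in> borel_measurable ?R"
    by (rule measurable_in_subalg[OF sub(1)], rule measurable_compose[OF Zm measurable_ennreal])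
  have "restr_to_subalg Q (F t) = density ?R (\<lambda>\<omega>. ennreal (Z t \<omega>))"
  proof (rule measure_eqI)
    show "sets (restr_to_subalg Q (F t)) = sets (density ?R (\<lambda>\<omega>. ennreal (Z t \<omega>)))"
      using sub by (simp add: sets_restr_to_subalg)
    fix A assume "A \<in> sets (restr_to_subalg Q (F t))"
    then have A: "A \<in> sets (F t)"
      using sub by (simp add: sets_restr_to_subalg)
    have "emeasure (density ?R (\<lambda>\<omega>. ennreal (Z t \<omega>))) A
        = (\<integral>\<^sup>+\<omega>. ennreal (Z t \<omega>) * indicator A \<omega> \<partial>?R)"
      using A sub ZR by (intro emeasure_density) (auto simp: sets_restr_to_subalg)
    also have "\<dots> = (\<integral>\<^sup>+\<omega>. ennreal (Z t \<omega>) * indicator A \<omega> \<partial>P)"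
      using A sub(1) Zm by (intro nn_integral_subalgebra2) auto
    also have "\<dots> = emeasure (restr_to_subalg Q (F t)) A"
      using A assms sub by (simp add: emeasure_restr_to_subalg emeasure_Q_F)
    finally show "emeasure (restr_to_subalg Q (F t)) A = emeasure (density ?R (\<lambda>\<omega>. ennreal (Z t \<omega>))) A"
      by simp
  qed
  then have "(\<integral>\<^sup>+\<omega>. 1 / ennreal (Z t \<omega>) \<partial>Q)
      = (\<integral>\<^sup>+\<omega>. 1 / ennreal (Z t \<omega>) \<partial>density ?R (\<lambda>\<omega>. ennreal (Z t \<omega>)))"
    using nn_integral_subalgebra2[OF sub(2) meas] by simp
  also have "\<dots> = (\<integral>\<^sup>+\<omega>. ennreal (Z t \<omega>) * (1 / ennreal (Z t \<omega>)) \<partial>?R)"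
    using ZR meas measurable_in_subalg[OF sub(1)] by (intro nn_integral_density) auto
  also have "\<dots> = (\<integral>\<^sup>+\<omega>. ennreal (Z t \<omega>) * (1 / ennreal (Z t \<omega>)) \<partial>P)"
    using Zm by (intro nn_integral_subalgebra2[OF sub(1)]) auto
  also have "\<dots> = (\<integral>\<^sup>+\<omega>. indicator {\<omega> \<in> space P. Z t \<omega> > 0} \<omega> \<partial>P)"
  proof (rule nn_integral_cong)
    fix \<omega> assume "\<omega> \<in> space P"
    show "ennreal (Z t \<omega>) * (1 / ennreal (Z t \<omega>)) = indicator {\<omega> \<in> space P. Z t \<omega> > 0} \<omega>"
    proof (cases "Z t \<omega> > 0")
      case True
      then show ?thesis
        using \<open>\<omega> \<in> space P\<close> ennreal_divide_self[of "ennreal (Z t \<omega>)"]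
        by (simp add: ennreal_times_divide)
    next
      case False
      then show ?thesis
        by (simp add: ennreal_neg)
    qed
  qed
  also have "\<dots> = emeasure P {\<omega> \<in> space P. Z t \<omega> > 0}"
    using Z_measurable[OF assms] by (intro nn_integral_indicator) measurable
  finally show ?thesis
    by simp
qed

text \<open>
  Whatever open condition holds at a time of \<open>T\<close> also holds at a rational time shortly after, or at
  that time itself. This is the form in which right-continuity replaces arbitrary times by times in \<open>D\<close>.
\<close>

lemma right_dense:
  assumes "\<omega> \<in> space P" "t \<in> T" "open U" "Z t \<omega> \<in> U" "t < u"
  obtains q where "q \<in> D" "t \<le> q" "q < u" "Z q \<omega> \<in> U"
  using time
proof
  assume "T = \<nat>"
  then have "t \<in> D"
    using \<open>t \<in> T\<close> Nats_subset_Rats unfolding D_def by blast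
  then show ?thesis
    using that assms by blast
next
  assume T: "T = {0..}"
  then have "((\<lambda>t. Z t \<omega>) \<longlongrightarrow> Z t \<omega>) (at_right t)"
    using cadlag[OF assms(1)] \<open>t \<in> T\<close> by (auto simp: cadlag_on_atLeast)
  then have "\<forall>\<^sub>F q in at_right t. Z q \<omega> \<in> U"
    using \<open>open U\<close> \<open>Z t \<omega> \<in> U\<close> by (rule topological_tendstoD)
  then obtain v where v: "t < v" "\<And>q. t < q \<Longrightarrow> q < v \<Longrightarrow> Z q \<omega> \<in> U"
    by (auto simp: eventually_at_right_field)
  obtain q where "q \<in> \<rat>" "t < q" "q < min u v"
    using Rats_dense_in_real[of t "min u v"] v \<open>t < u\<close> by auto
  then show ?thesis
    using v T \<open>t \<in> T\<close> that[of q] unfolding D_def by auto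
qed

lemma right_neighbourhood_positive:
  assumes "\<omega> \<in> space P" "t \<in> T" "Z t \<omega> > 0"
  obtains u where "t < u" "\<And>s. s \<in> T \<Longrightarrow> t \<le> s \<Longrightarrow> s < u \<Longrightarrow> Z s \<omega> > 0"
proof -
  have "((\<lambda>t. Z t \<omega>) \<longlongrightarrow> Z t \<omega>) (at t within T \<inter> {t<..})"
    using cadlag[OF assms(1)] \<open>t \<in> T\<close> by (auto simp: cadlag_on_def)
  then have "\<forall>\<^sub>F s in at t within T \<inter> {t<..}. Z s \<omega> > 0"
    using \<open>Z t \<omega> > 0\<close> by (rule order_tendstoD)
  then obtain d where d: "d > 0" "\<And>s. s \<in> T \<inter> {t<..} \<Longrightarrow> s \<noteq> t \<Longrightarrow> dist s t < d \<Longrightarrow> Z s \<omega> > 0"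
    by (auto simp: eventually_at)
  show ?thesis
  proof (rule that[of "t + d"])
    show "Z s \<omega> > 0" if "s \<in> T" "t \<le> s" "s < t + d" for s
      using d that \<open>Z t \<omega> > 0\<close> by (cases "s = t") (auto simp: dist_real_def)
  qed (use d in simp)
qed

section \<open>Extinction\<close>

text \<open>
  A countable stand-in, measurable for \<open>F t\<close>, for the event that \<open>Z\<close> vanishes at some time before \<open>t\<close>:
  that event is contained in it by right-continuity.
\<close>

definition approaches_zero_before :: "real \<Rightarrow> 'a set" where
  "approaches_zero_before t = (\<Inter>k. \<Union>q\<in>D \<inter> {..<t}. {\<omega> \<in> space P. Z q \<omega> < 1 / real (Suc k)})"

lemma approaches_zero_before_F:
  assumes "t \<in> T"
  shows "approaches_zero_before t \<in> sets (F t)"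
  unfolding approaches_zero_before_def
  using countable_D D_subset assms
  by (intro sets.countable_INT sets.countable_UN') (auto intro!: sets_F_mono[OF level_sets_F(1)])

text \<open>
  At the first passage below \<open>1 / (k + 1)\<close> the density is at most that, so \<open>Q\<close> gives the passage event at
  most \<open>1 / (k + 1)\<close>.
\<close>

lemma Q_approaches_zero_before:
  assumes "t \<in> T"
  shows "emeasure Q (approaches_zero_before t) = 0"
proof -
  have "emeasure Q (approaches_zero_before t) \<le> ennreal (1 / Suc k)" for k
  proof -
    let ?H = "\<Union>q\<in>D \<inter> {..<t}. {\<omega> \<in> space P. Z q \<omega> < 1 / real (Suc k)}"
    have H: "?H \<in> sets P"
      using countable_D D_subset by (intro sets.countable_UN') (auto intro!: sets_F[OF _ level_sets_F(1)])
    have 0: "0 \<in> T"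
      using of_nat_in_T[of 0] by simp
    have "emeasure Q (space P \<inter> ?H) \<le> emeasure (scale_measure (ennreal (1 / Suc k)) P) (space P \<inter> ?H)"
    proof (rule emeasure_le_hitting[OF filtration_Q])
      show "space P \<in> sets (F 0)"
        using space_F[OF 0] sets.top by metis
      show "D \<inter> {..<t} \<subseteq> T \<inter> {0..}"
        using D_subset T_nonneg by auto
    qed (use 0 countable_D sets_eq level_sets_F(1) Q_le_scaled in auto)
    also have "space P \<inter> ?H = ?H"
      by auto
    also have "emeasure (scale_measure (ennreal (1 / Suc k)) P) ?H \<le> ennreal (1 / Suc k) * 1"
      using prob_space.emeasure_le_1[OF prob_P] by (simp del: mult_1_right add: mult_left_mono)
    finally have "emeasure Q ?H \<le> ennreal (1 / Suc k)"
      by simp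
    moreover have "emeasure Q (approaches_zero_before t) \<le> emeasure Q ?H"
      using H by (intro emeasure_mono) (auto simp: approaches_zero_before_def sets_eq)
    ultimately show ?thesis
      by simp
  qed
  then show ?thesis
    by (rule ennreal_eq_0_if_le_inverse_Suc)
qed

text \<open>
  Zero is absorbing for \<open>Z\<close> under \<open>P\<close>: the \<open>P\<close>-integral of \<open>Z t\<close> over an event of \<open>F t\<close> is its
  \<open>Q\<close>-measure, which is zero here.
\<close>

lemma positive_after_zero_null:
  assumes "t \<in> T"
  shows "approaches_zero_before t \<inter> {\<omega> \<in> space P. Z t \<omega> > 0} \<in> null_sets P"
proof -
  note N = sets_F[OF assms approaches_zero_before_F[OF assms]]
  have [measurable]: "Z t \<in> borel_measurable P"
    using assms by (rule Z_measurable)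
  have "(\<integral>\<^sup>+\<omega>. ennreal (Z t \<omega>) * indicator (approaches_zero_before t) \<omega> \<partial>P) = 0"
    using Q_approaches_zero_before emeasure_Q_F approaches_zero_before_F assms by metis
  then have "AE \<omega> in P. ennreal (Z t \<omega>) * indicator (approaches_zero_before t) \<omega> = 0"
    using N by (subst (asm) nn_integral_0_iff_AE) auto
  then have "AE \<omega> in P. \<not> (\<omega> \<in> approaches_zero_before t \<and> Z t \<omega> > 0)"
    by eventually_elim (auto simp: indicator_def split: if_splits)
  moreover have "approaches_zero_before t \<inter> {\<omega> \<in> space P. Z t \<omega> > 0} \<in> sets P"
    using N by auto
  ultimately show ?thesis
    by (subst (asm) AE_iff_measurable) (auto simp: null_sets_def approaches_zero_before_def)
qed

text \<open>
  If \<open>Z t > 0\<close>, then \<open>Z\<close> stays positive on some \<open>[t, u)\<close>. So an extinction time of at most \<open>t\<close>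
  comes from an actual zero strictly before \<open>t\<close>, whether or not the infimum is attained.
\<close>

lemma approaches_zero_if_extinct_and_positive:
  assumes "t \<in> T" "\<omega> \<in> space P" "extinction_time T Z \<omega> \<le> ereal t" "Z t \<omega> > 0"
  shows "\<omega> \<in> approaches_zero_before t"
proof -
  obtain u where u: "t < u" "\<And>s. s \<in> T \<Longrightarrow> t \<le> s \<Longrightarrow> s < u \<Longrightarrow> Z s \<omega> > 0"
    using right_neighbourhood_positive assms by metis
  have "Inf (ereal ` {t \<in> T. Z t \<omega> = 0}) < ereal u"
    using assms u by (auto simp: extinction_time_def intro: le_less_trans)
  then obtain s where s: "s \<in> T" "Z s \<omega> = 0" "s < u"
    by (auto simp: Inf_less_iff)
  then have "s < t"
    using u(2)[of s] by force
  have "\<exists>q\<in>D \<inter> {..<t}. Z q \<omega> < 1 / Suc k" for k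
    using right_dense[of \<omega> s "{..<1 / Suc k}" t] s \<open>s < t\<close> assms by force
  then show ?thesis
    using assms by (auto simp: approaches_zero_before_def)
qed

lemma extinction_time_law:
  assumes "t \<in> T"
  shows "{\<omega> \<in> space P. extinction_time T Z \<omega> > ereal t} \<in> sets (completion P)"
    and "emeasure (completion P) {\<omega> \<in> space P. extinction_time T Z \<omega> > ereal t}
           = emeasure P {\<omega> \<in> space P. Z t \<omega> > 0}"
proof -
  let ?alive = "{\<omega> \<in> space P. extinction_time T Z \<omega> > ereal t}"
  let ?pos = "{\<omega> \<in> space P. Z t \<omega> > 0}"
  have pos: "?pos \<in> sets P"
    using Z_measurable[OF assms] by measurable
  have "?alive \<subseteq> ?pos"
  proof safe
    fix \<omega> assume \<omega>: "\<omega> \<in> space P" "ereal t < extinction_time T Z \<omega>"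
    have "Z t \<omega> \<noteq> 0"
    proof
      assume "Z t \<omega> = 0"
      then have "extinction_time T Z \<omega> \<le> ereal t"
        using assms unfolding extinction_time_def by (intro Inf_lower) auto
      then show False
        using \<omega> by simp
    qed
    then show "Z t \<omega> > 0"
      using nonneg[OF assms \<omega>(1)] by simp
  qed
  then have eq: "?alive = ?pos - (?pos - ?alive)"
    by auto
  have "?pos - ?alive \<subseteq> approaches_zero_before t \<inter> ?pos"
    using approaches_zero_if_extinct_and_positive[OF assms] not_less by blast
  then have null: "?pos - ?alive \<in> null_sets (completion P)"
    using positive_after_zero_null[OF assms]
    by (intro null_sets_completion_subset[OF _ null_sets_completionI])
  have "?pos - (?pos - ?alive) \<in> sets (completion P)"
    using sets_completionI_sets[OF pos] null_setsD2[OF null] by (rule sets.Diff)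
  then show "?alive \<in> sets (completion P)"
    using eq by metis
  have "emeasure (completion P) (?pos - (?pos - ?alive)) = emeasure (completion P) ?pos"
    using pos null by (intro emeasure_Diff_null_set) auto
  then show "emeasure (completion P) ?alive = emeasure P ?pos"
    using eq pos by simp
qed

section \<open>Tail events and the limit superior\<close>

definition stays_below :: "real \<Rightarrow> nat \<Rightarrow> 'a set" where
  "stays_below b n = (\<Inter>t\<in>D \<inter> {real n..}. {\<omega> \<in> space P. Z t \<omega> < b})"

definition eventually_below :: "real \<Rightarrow> 'a set" where
  "eventually_below b = (\<Union>n. stays_below b n)"

definition frequently_above :: "real \<Rightarrow> 'a set" where
  "frequently_above a = (\<Inter>m. \<Union>t\<in>D \<inter> {real m..}. {\<omega> \<in> space P. a \<le> Z t \<omega>})"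

lemma stays_below_sets: "stays_below b n \<in> sets P"
proof -
  have "real n \<in> D \<inter> {real n..}"
    by simp
  then show ?thesis
    unfolding stays_below_def
    using countable_D D_subset
    by (intro sets.countable_INT') (blast, blast, auto intro!: sets_F[OF _ level_sets_F(1)])
qed

lemma eventually_below_sets: "eventually_below b \<in> sets P"
  unfolding eventually_below_def using stays_below_sets by auto

lemma passage_sets: "(\<Union>t\<in>D \<inter> {real m..}. {\<omega> \<in> space P. a \<le> Z t \<omega>}) \<in> sets P"
  using countable_D D_subset by (intro sets.countable_UN') (auto intro!: sets_F[OF _ level_sets_F(2)])

lemma frequently_above_sets: "frequently_above a \<in> sets P"
  unfolding frequently_above_def using passage_sets by (intro sets.countable_INT) auto

lemma eventually_below_subset: "eventually_below b \<subseteq> space P"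
  using eventually_below_sets by (rule sets.sets_into_space)

lemma frequently_above_subset: "frequently_above a \<subseteq> space P"
  using frequently_above_sets by (rule sets.sets_into_space)

lemma incseq_stays_below: "incseq (stays_below b)"
  by (force simp: incseq_def stays_below_def)

lemma eventually_below_mono: "a \<le> b \<Longrightarrow> eventually_below a \<subseteq> eventually_below b"
  by (force simp: eventually_below_def stays_below_def)

lemma frequently_above_eq: "frequently_above a = space P - eventually_below a"
proof -
  have "\<omega> \<in> stays_below a n \<longleftrightarrow> (\<forall>t\<in>D \<inter> {real n..}. Z t \<omega> < a)" if "\<omega> \<in> space P" for \<omega> n
    using that by (auto simp: stays_below_def)
  then have "\<omega> \<in> frequently_above a \<longleftrightarrow> \<omega> \<notin> eventually_below a" if "\<omega> \<in> space P" for \<omega>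
    using that by (force simp: frequently_above_def eventually_below_def not_less)
  then show ?thesis
    using frequently_above_subset by blast
qed

text \<open>
  The strict bound on rational times only yields a weak bound on all times, so \<open>eventually_below b\<close>
  sits between \<open>L < b\<close> and \<open>L \<le> b\<close>. These two inclusions are all that is used about \<open>L\<close>; the boundary case
  \<open>L = b\<close> is left undecided.
\<close>

lemma limsup_le_of_eventually_below:
  assumes "\<omega> \<in> eventually_below b"
  shows "L \<omega> \<le> ennreal b"
proof -
  have \<omega>: "\<omega> \<in> space P"
    using assms eventually_below_subset by blast
  obtain n where n: "\<omega> \<in> stays_below b n"
    using assms by (auto simp: eventually_below_def)
  have "Z t \<omega> \<le> b" if "t \<in> T" "real n \<le> t" for t
  proof (rule ccontr)
    assume "\<not> Z t \<omega> \<le> b"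
    then obtain q where "q \<in> D" "t \<le> q" "Z q \<omega> > b"
      using right_dense[OF \<omega> \<open>t \<in> T\<close>, of "{b<..}" "t + 1"] by auto
    then show False
      using n that by (force simp: stays_below_def)
  qed
  then have "\<forall>\<^sub>F t in inf at_top (principal T). ennreal (Z t \<omega>) \<le> ennreal b"
    by (auto simp: eventually_inf_principal eventually_at_top_linorder intro!: ennreal_leI)
  then show ?thesis
    unfolding limsup_process_def by (rule Limsup_bounded)
qed

lemma eventually_below_of_limsup_less:
  assumes "\<omega> \<in> space P" "L \<omega> < ennreal b"
  shows "\<omega> \<in> eventually_below b"
proof -
  have "\<forall>\<^sub>F t in inf at_top (principal T). ennreal (Z t \<omega>) < ennreal b"
    using assms(2) unfolding limsup_process_def by (rule Limsup_lessD)
  then obtain N where N: "\<And>t. t \<in> T \<Longrightarrow> N \<le> t \<Longrightarrow> ennreal (Z t \<omega>) < ennreal b"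
    by (auto simp: eventually_inf_principal eventually_at_top_linorder)
  obtain n :: nat where "N \<le> real n"
    using real_arch_simple by blast
  then have "Z t \<omega> < b" if "t \<in> D" "real n \<le> t" for t
    using N[of t] that D_subset nonneg[OF _ assms(1)] by (auto simp: ennreal_less_iff)
  then show ?thesis
    using assms(1) by (auto simp: eventually_below_def stays_below_def)
qed

lemma limsup_ge_of_frequently_above:
  "\<omega> \<in> frequently_above a \<Longrightarrow> ennreal a \<le> L \<omega>"
  using eventually_below_of_limsup_less by (force simp: frequently_above_eq not_less[symmetric])

lemma L_measurable: "L \<in> borel_measurable P"
proof (rule borel_measurableI_less)
  fix c :: ennreal
  have "{\<omega> \<in> space P. L \<omega> < c} = (\<Union>q\<in>{q \<in> \<rat>. ennreal q < c}. eventually_below q)"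
  proof (intro set_eqI iffI)
    fix \<omega> assume \<omega>: "\<omega> \<in> {\<omega> \<in> space P. L \<omega> < c}"
    then obtain q :: rat where "L \<omega> < ennreal (of_rat q)" "ennreal (of_rat q) < c"
      using ennreal_rat_dense[of "L \<omega>" c] by auto
    then show "\<omega> \<in> (\<Union>q\<in>{q \<in> \<rat>. ennreal q < c}. eventually_below q)"
      using \<omega> eventually_below_of_limsup_less by (auto intro!: exI[of _ "real_of_rat q"])
  next
    fix \<omega> assume "\<omega> \<in> (\<Union>q\<in>{q \<in> \<rat>. ennreal q < c}. eventually_below q)"
    then show "\<omega> \<in> {\<omega> \<in> space P. L \<omega> < c}"
      using limsup_le_of_eventually_below eventually_below_subset by (force intro: le_less_trans)
  qed
  also have "\<dots> \<in> sets P"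
    using eventually_below_sets by (intro sets.countable_UN') (auto intro: countable_subset[OF _ countable_rat])
  finally show "{\<omega> \<in> space P. L \<omega> < c} \<in> sets P" .
qed

section \<open>Comparison of the measures on bands of the limit superior\<close>

lemma finite_scaled: "finite_measure (scale_measure (ennreal c) P)"
  using finite_P by (rule finite_measure_scale_measure)

text \<open>
  The next two lemmas are the basic comparisons for tail events: looking at the last time for
  staying below \<open>b\<close>, and first passage after \<open>m\<close>, for every late \<open>m\<close>, for returning above \<open>a\<close>.
\<close>

lemma Q_le_scaled_stays_below:
  assumes "s \<in> T" "A \<in> sets (F s)"
  shows "emeasure Q (A \<inter> stays_below b n) \<le> emeasure (scale_measure (ennreal b) P) (A \<inter> stays_below b n)"
proof -
  obtain m where "max s (real n) \<le> real m"
    using real_arch_simple by blast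
  show ?thesis
    unfolding stays_below_def
  proof (rule emeasure_le_avoiding[OF finite_Q finite_scaled filtration_Q])
    show "countable (D \<inter> {real n..})" "D \<inter> {real n..} \<subseteq> T"
      using countable_D D_subset by auto
    show "real m \<in> D \<inter> {real n..}" "s \<le> real m"
      using \<open>max s (real n) \<le> real m\<close> by auto
  qed (use assms sets_eq level_sets_F(1) Q_le_scaled in auto)
qed

lemma scaled_le_Q_frequently_above:
  assumes "s \<in> T" "A \<in> sets (F s)"
  shows "emeasure (scale_measure (ennreal a) P) (A \<inter> frequently_above a) \<le> emeasure Q (A \<inter> frequently_above a)"
proof -
  obtain m where m: "s \<le> real m"
    using real_arch_simple by blast
  define H where "H i = (\<Union>t\<in>D \<inter> {real (m + i)..}. {\<omega> \<in> space P. a \<le> Z t \<omega>})" for i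
  have H: "frequently_above a = (\<Inter>i. H i)"
  proof (intro set_eqI iffI)
    fix \<omega> assume "\<omega> \<in> (\<Inter>i. H i)"
    moreover have "H i \<subseteq> (\<Union>t\<in>D \<inter> {real i..}. {\<omega> \<in> space P. a \<le> Z t \<omega>})" for i
      by (force simp: H_def)
    ultimately show "\<omega> \<in> frequently_above a"
      unfolding frequently_above_def by blast
  qed (unfold frequently_above_def H_def, blast)
  have "emeasure (scale_measure (ennreal a) P) (\<Inter>i. A \<inter> H i) \<le> emeasure Q (\<Inter>i. A \<inter> H i)"
  proof (rule emeasure_le_INT_decseq[OF finite_scaled finite_Q])
    show "range (\<lambda>i. A \<inter> H i) \<subseteq> sets (scale_measure (ennreal a) P)"
      using sets.Int[OF sets_F[OF assms] passage_sets] by (simp add: H_def image_subset_iff del: of_nat_add)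
    show "decseq (\<lambda>i. A \<inter> H i)"
      by (force simp: decseq_def H_def)
    show "emeasure (scale_measure (ennreal a) P) (A \<inter> H i) \<le> emeasure Q (A \<inter> H i)" for i
      unfolding H_def
    proof (rule emeasure_le_hitting[OF filtration_scaled])
      show "countable (D \<inter> {real (m + i)..})"
        using countable_D by auto
      show "D \<inter> {real (m + i)..} \<subseteq> T \<inter> {s..}"
        using D_subset m by auto
    qed (use assms sets_eq level_sets_F(2) scaled_le_Q in auto)
  qed (simp add: sets_eq)
  then show ?thesis
    by (simp add: H)
qed

lemma space_in_F0: "space P \<in> sets (F 0)" and zero_in_T: "0 \<in> T"
proof -
  show "0 \<in> T"
    using of_nat_in_T[of 0] by simp
  then show "space P \<in> sets (F 0)"
    using space_F sets.top by metis
qed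

text \<open>
  The events \<open>eventually_below b\<close> and \<open>frequently_above a\<close> are not in any single \<open>F s\<close>, so the
  preceding lemmas do not apply to one with the other in place of \<open>A\<close>. Here \<open>frequently_above a\<close> is
  approximated: finitely many passages above \<open>a\<close> form an event of some \<open>F s\<close>, and then infinitely many
  passage times after \<open>m\<close> are allowed, and then \<open>m\<close> tends to infinity.
\<close>

lemma Q_le_scaled_band:
  "emeasure Q (eventually_below b \<inter> frequently_above a)
     \<le> emeasure (scale_measure (ennreal b) P) (eventually_below b \<inter> frequently_above a)"
proof -
  let ?H = "\<lambda>m. \<Union>t\<in>D \<inter> {real m..}. {\<omega> \<in> space P. a \<le> Z t \<omega>}"
  have passage: "emeasure Q (stays_below b n \<inter> ?H m)
      \<le> emeasure (scale_measure (ennreal b) P) (stays_below b n \<inter> ?H m)" for n m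
  proof (rule emeasure_le_UN_finite_subsets)
    fix K assume K: "finite K" "K \<subseteq> D \<inter> {real m..}"
    define s where "s = Max (insert 0 K)"
    have s: "s \<in> T" "\<And>t. t \<in> K \<Longrightarrow> t \<le> s"
      using K D_subset zero_in_T Max_in[of "insert 0 K"] by (auto simp: s_def)
    have "(\<Union>t\<in>K. {\<omega> \<in> space P. a \<le> Z t \<omega>}) \<in> sets (F s)"
      using K D_subset s by (intro sets.finite_UN sets_F_mono[OF level_sets_F(2)]) auto
    from Q_le_scaled_stays_below[OF s(1) this]
    show "emeasure Q (stays_below b n \<inter> (\<Union>t\<in>K. {\<omega> \<in> space P. a \<le> Z t \<omega>}))
      \<le> emeasure (scale_measure (ennreal b) P) (stays_below b n \<inter> (\<Union>t\<in>K. {\<omega> \<in> space P. a \<le> Z t \<omega>}))"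
      by (simp only: Int_commute)
  qed (use countable_D D_subset stays_below_sets sets_eq in \<open>auto intro!: sets_F[OF _ level_sets_F(2)]\<close>)
  have "emeasure Q (stays_below b n \<inter> frequently_above a)
      \<le> emeasure (scale_measure (ennreal b) P) (stays_below b n \<inter> frequently_above a)" for n
  proof -
    have "emeasure Q (\<Inter>m. stays_below b n \<inter> ?H m)
        \<le> emeasure (scale_measure (ennreal b) P) (\<Inter>m. stays_below b n \<inter> ?H m)"
    proof (rule emeasure_le_INT_decseq[OF finite_Q finite_scaled])
      show "range (\<lambda>m. stays_below b n \<inter> ?H m) \<subseteq> sets Q"
        using stays_below_sets passage_sets sets_eq by auto
      show "decseq (\<lambda>m. stays_below b n \<inter> ?H m)"
        by (force simp: decseq_def)
    qed (use passage sets_eq in auto)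
    then show ?thesis
      by (simp add: frequently_above_def)
  qed
  then have "emeasure Q (\<Union>n. stays_below b n \<inter> frequently_above a)
      \<le> emeasure (scale_measure (ennreal b) P) (\<Union>n. stays_below b n \<inter> frequently_above a)"
    using stays_below_sets frequently_above_sets sets_eq incseqD[OF incseq_stays_below[of b]]
    by (intro emeasure_le_UN_incseq) (force simp: incseq_def)+
  then show ?thesis
    by (simp add: eventually_below_def)
qed

text \<open>
  This time \<open>eventually_below b\<close> is approximated: staying below \<open>b\<close> at finitely many times is an event
  of some \<open>F s\<close>.
\<close>

lemma scaled_le_Q_band:
  "emeasure (scale_measure (ennreal a) P) (eventually_below b \<inter> frequently_above a)
     \<le> emeasure Q (eventually_below b \<inter> frequently_above a)"
proof -
  have "emeasure (scale_measure (ennreal a) P) (frequently_above a \<inter> stays_below b n)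
      \<le> emeasure Q (frequently_above a \<inter> stays_below b n)" for n
    unfolding stays_below_def
  proof (rule emeasure_le_INT_finite_subsets[OF finite_scaled finite_Q, where K\<^sub>0 = "{real n}"])
    fix K assume K: "finite K" "{real n} \<subseteq> K" "K \<subseteq> D \<inter> {real n..}"
    define s where "s = Max K"
    have "s \<in> K"
      using K by (auto simp: s_def intro!: Max_in)
    then have s: "s \<in> T" "\<And>t. t \<in> K \<Longrightarrow> t \<le> s"
      using K D_subset by (auto simp: s_def)
    have "(\<Inter>t\<in>K. {\<omega> \<in> space P. Z t \<omega> < b}) \<in> sets (F s)"
      using K D_subset s by (intro sets.finite_INT sets_F_mono[OF level_sets_F(1)]) auto
    from scaled_le_Q_frequently_above[OF s(1) this]
    show "emeasure (scale_measure (ennreal a) P) (frequently_above a \<inter> (\<Inter>t\<in>K. {\<omega> \<in> space P. Z t \<omega> < b}))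
      \<le> emeasure Q (frequently_above a \<inter> (\<Inter>t\<in>K. {\<omega> \<in> space P. Z t \<omega> < b}))"
      by (simp only: Int_commute)
  qed (use countable_D D_subset frequently_above_sets sets_eq in \<open>auto intro!: sets_F[OF _ level_sets_F(1)]\<close>)
  then have "emeasure (scale_measure (ennreal a) P) (\<Union>n. frequently_above a \<inter> stays_below b n)
      \<le> emeasure Q (\<Union>n. frequently_above a \<inter> stays_below b n)"
    using stays_below_sets frequently_above_sets sets_eq incseqD[OF incseq_stays_below[of b]]
    by (intro emeasure_le_UN_incseq) (force simp: incseq_def)+
  then show ?thesis
    by (simp add: eventually_below_def Int_commute)
qed

text \<open>
  The two exceptional values of \<open>L\<close> come from one-sided comparisons: \<open>Q\<close> of \<open>eventually_below b\<close> is at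
  most \<open>b\<close>, and \<open>P\<close> of \<open>frequently_above a\<close> is at most \<open>1 / a\<close>.
\<close>

lemma Q_limsup_zero: "AE \<omega> in Q. L \<omega> \<noteq> 0"
proof -
  have LQ [measurable]: "L \<in> borel_measurable Q"
    using L_measurable sets_eq by (simp cong: measurable_cong_sets)
  let ?N = "{\<omega> \<in> space Q. \<not> L \<omega> \<noteq> 0}"
  have "emeasure Q ?N \<le> ennreal (1 / real (Suc k))" for k
  proof -
    let ?b = "1 / real (Suc k)"
    have "emeasure Q (\<Union>n. space P \<inter> stays_below ?b n)
        \<le> emeasure (scale_measure (ennreal ?b) P) (\<Union>n. space P \<inter> stays_below ?b n)"
    proof (rule emeasure_le_UN_incseq)
      show "incseq (\<lambda>n. space P \<inter> stays_below ?b n)"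
        using incseqD[OF incseq_stays_below[of ?b]] by (force simp: incseq_def)
      show "emeasure Q (space P \<inter> stays_below ?b n)
          \<le> emeasure (scale_measure (ennreal ?b) P) (space P \<inter> stays_below ?b n)" for n
        by (rule Q_le_scaled_stays_below[OF zero_in_T space_in_F0])
    qed (use stays_below_sets sets_eq in auto)
    also have "(\<Union>n. space P \<inter> stays_below ?b n) = eventually_below ?b"
      using eventually_below_subset by (auto simp: eventually_below_def)
    also have "emeasure (scale_measure (ennreal ?b) P) (eventually_below ?b) \<le> ennreal ?b * 1"
      using prob_space.emeasure_le_1[OF prob_P] by (simp del: mult_1_right add: mult_left_mono)
    finally have "emeasure Q (eventually_below ?b) \<le> ennreal ?b"
      by simp
    moreover have "?N \<subseteq> eventually_below ?b"
      using eventually_below_of_limsup_less space_eq by auto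
    then have "emeasure Q ?N \<le> emeasure Q (eventually_below ?b)"
      using eventually_below_sets sets_eq by (intro emeasure_mono) auto
    ultimately show ?thesis
      by simp
  qed
  then have "emeasure Q ?N = 0"
    by (rule ennreal_eq_0_if_le_inverse_Suc)
  then show ?thesis
    by (subst AE_iff_measurable[OF _ refl]) auto
qed

lemma P_limsup_infinite: "AE \<omega> in P. L \<omega> \<noteq> \<infinity>"
proof -
  have [measurable]: "L \<in> borel_measurable P"
    by (rule L_measurable)
  let ?N = "{\<omega> \<in> space P. \<not> L \<omega> \<noteq> \<infinity>}"
  have "emeasure P ?N \<le> ennreal (1 / real (Suc k))" for k
  proof -
    let ?a = "real (Suc k)"
    have "?N \<subseteq> frequently_above ?a"
      using limsup_le_of_eventually_below by (force simp: frequently_above_eq top_unique)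
    then have "ennreal ?a * emeasure P ?N \<le> ennreal ?a * emeasure P (frequently_above ?a)"
      using frequently_above_sets by (intro mult_left_mono emeasure_mono) auto
    also have "\<dots> \<le> emeasure Q (frequently_above ?a)"
      using scaled_le_Q_frequently_above[OF zero_in_T space_in_F0, of ?a] frequently_above_subset[of ?a]
      by (simp add: Int_absorb1)
    also have "\<dots> \<le> 1"
      by (rule prob_space.emeasure_le_1[OF prob_Q])
    finally have "ennreal (1 / ?a) * (ennreal ?a * emeasure P ?N) \<le> ennreal (1 / ?a) * 1"
      by (intro mult_left_mono) auto
    then show ?thesis
      by (simp add: mult.assoc[symmetric] ennreal_mult[symmetric] del: of_nat_Suc)
  qed
  then have "emeasure P ?N = 0"
    by (rule ennreal_eq_0_if_le_inverse_Suc)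
  then show ?thesis
    by (subst AE_iff_measurable[OF _ refl]) auto
qed

section \<open>Integrating the inverse limit superior\<close>

lemma inverse_limsup_on_band:
  assumes "0 < a" "a \<le> b"
  defines "B \<equiv> eventually_below b \<inter> frequently_above a"
  shows "emeasure (density Q (\<lambda>\<omega>. 1 / L \<omega>)) B \<le> ennreal (b / a) * emeasure P B"
    and "ennreal (a / b) * emeasure P B \<le> emeasure (density Q (\<lambda>\<omega>. 1 / L \<omega>)) B"
proof -
  have LQ [measurable]: "L \<in> borel_measurable Q"
    using L_measurable sets_eq by (simp cong: measurable_cong_sets)
  have B: "B \<in> sets Q"
    using eventually_below_sets frequently_above_sets sets_eq by (simp add: B_def)
  have dens: "emeasure (density Q (\<lambda>\<omega>. 1 / L \<omega>)) B = (\<integral>\<^sup>+\<omega>. 1 / L \<omega> * indicator B \<omega> \<partial>Q)"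
    using B by (intro emeasure_density) auto
  have L: "ennreal a \<le> L \<omega>" "L \<omega> \<le> ennreal b" if "\<omega> \<in> B" for \<omega>
    using that limsup_le_of_eventually_below limsup_ge_of_frequently_above by (auto simp: B_def)
  have inv: "ennreal (1 / b) \<le> 1 / L \<omega>" "1 / L \<omega> \<le> ennreal (1 / a)" if \<omega>: "\<omega> \<in> B" for \<omega>
  proof -
    obtain l where l: "L \<omega> = ennreal l" "a \<le> l" "l \<le> b"
      using L[OF \<omega>] assms by (cases "L \<omega>") (auto simp: top_unique)
    then have "1 / L \<omega> = ennreal (1 / l)"
      using assms divide_ennreal[of 1 l] by simp
    then show "ennreal (1 / b) \<le> 1 / L \<omega>" "1 / L \<omega> \<le> ennreal (1 / a)"
      using l assms by (auto intro!: ennreal_leI divide_left_mono)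
  qed
  have "emeasure (density Q (\<lambda>\<omega>. 1 / L \<omega>)) B \<le> (\<integral>\<^sup>+\<omega>. ennreal (1 / a) * indicator B \<omega> \<partial>Q)"
    unfolding dens using inv by (intro nn_integral_mono) (auto simp: indicator_def)
  also have "\<dots> = ennreal (1 / a) * emeasure Q B"
    using B by (simp add: nn_integral_cmult_indicator)
  also have "\<dots> \<le> ennreal (1 / a) * (ennreal b * emeasure P B)"
    using Q_le_scaled_band[of b a] by (intro mult_left_mono) (auto simp: B_def)
  also have "\<dots> = ennreal (b / a) * emeasure P B"
    using assms by (simp add: mult.assoc[symmetric] ennreal_mult[symmetric])
  finally show "emeasure (density Q (\<lambda>\<omega>. 1 / L \<omega>)) B \<le> ennreal (b / a) * emeasure P B" .
  have "ennreal (a / b) * emeasure P B = ennreal (1 / b) * (ennreal a * emeasure P B)"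
    using assms by (simp add: mult.assoc[symmetric] ennreal_mult[symmetric])
  also have "\<dots> \<le> ennreal (1 / b) * emeasure Q B"
    using scaled_le_Q_band[of a b] by (intro mult_left_mono) (auto simp: B_def)
  also have "\<dots> = (\<integral>\<^sup>+\<omega>. ennreal (1 / b) * indicator B \<omega> \<partial>Q)"
    using B by (simp add: nn_integral_cmult_indicator)
  also have "\<dots> \<le> emeasure (density Q (\<lambda>\<omega>. 1 / L \<omega>)) B"
    unfolding dens using inv by (intro nn_integral_mono) (auto simp: indicator_def)
  finally show "ennreal (a / b) * emeasure P B \<le> emeasure (density Q (\<lambda>\<omega>. 1 / L \<omega>)) B" .
qed

definition geometric_band :: "real \<Rightarrow> int \<Rightarrow> 'a set" where
  "geometric_band r k = eventually_below (r powr (k + 1)) \<inter> frequently_above (r powr k)"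

lemma disjoint_geometric_bands:
  assumes "1 < r"
  shows "disjoint_family (geometric_band r)"
proof -
  have "geometric_band r j \<inter> geometric_band r k = {}" if "j < k" for j k
  proof -
    have "r powr (j + 1) \<le> r powr k"
      using assms that by (intro powr_mono) auto
    then show ?thesis
      using eventually_below_mono by (fastforce simp: geometric_band_def frequently_above_eq)
  qed
  then show ?thesis
    unfolding disjoint_family_on_def by (metis Int_commute linorder_neqE)
qed

text \<open>
  The logarithm of \<open>L\<close> finds the band up to the ambiguity of \<open>eventually_below\<close> at its boundary: if
  \<open>L = r\<^sup>k\<close>, the path may belong to band \<open>k\<close> or to band \<open>k - 1\<close>.
\<close>

lemma UN_geometric_bands:
  assumes "1 < r"
  shows "(\<Union>k. geometric_band r k) = {\<omega> \<in> space P. 0 < L \<omega> \<and> L \<omega> < \<infinity>}"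
proof (intro set_eqI iffI)
  fix \<omega> assume "\<omega> \<in> (\<Union>k. geometric_band r k)"
  then obtain k where k: "\<omega> \<in> eventually_below (r powr (k + 1))" "\<omega> \<in> frequently_above (r powr k)"
    by (auto simp: geometric_band_def)
  have "L \<omega> \<le> ennreal (r powr (k + 1))" "ennreal (r powr k) \<le> L \<omega>"
    using k by (auto intro: limsup_le_of_eventually_below limsup_ge_of_frequently_above)
  moreover have "0 < ennreal (r powr k)" "ennreal (r powr (k + 1)) < \<infinity>"
    using assms by auto
  ultimately show "\<omega> \<in> {\<omega> \<in> space P. 0 < L \<omega> \<and> L \<omega> < \<infinity>}"
    using k(1) eventually_below_subset less_le_trans le_less_trans by blast
next
  fix \<omega> assume "\<omega> \<in> {\<omega> \<in> space P. 0 < L \<omega> \<and> L \<omega> < \<infinity>}"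
  then obtain l where \<omega>: "\<omega> \<in> space P" and l: "L \<omega> = ennreal l" "0 < l"
    by (cases "L \<omega>") auto
  define k where "k = \<lfloor>log r l\<rfloor>"
  have k: "r powr k \<le> l" "l < r powr (k + 1)"
  proof -
    have "k \<le> log r l" "log r l < k + 1"
      by (auto simp: k_def)
    then show "r powr k \<le> l" "l < r powr (k + 1)"
      using assms l by (auto simp: le_log_iff log_less_iff)
  qed
  have below: "\<omega> \<in> eventually_below (r powr (k + 1))"
    using \<omega> l k by (intro eventually_below_of_limsup_less) (auto simp: ennreal_less_iff)
  show "\<omega> \<in> (\<Union>k. geometric_band r k)"
  proof (cases "\<omega> \<in> eventually_below (r powr k)")
    case False
    then have "\<omega> \<in> geometric_band r k"
      using below \<omega> by (simp add: geometric_band_def frequently_above_eq)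
    then show ?thesis
      by blast
  next
    case True
    have "r powr (k - 1) < l"
      using k assms by (intro less_le_trans[OF _ k(1)] powr_less_mono) auto
    then have "\<not> L \<omega> \<le> ennreal (r powr (k - 1))"
      using l by (simp add: not_le ennreal_less_iff)
    then have "\<omega> \<notin> eventually_below (r powr (k - 1))"
      using limsup_le_of_eventually_below by blast
    then have "\<omega> \<in> geometric_band r (k - 1)"
      using True \<omega> by (simp add: geometric_band_def frequently_above_eq)
    then show ?thesis
      by blast
  qed
qed

text \<open>
  On \<open>0 < L < \<infinity>\<close>, summing over the bands of ratio \<open>r\<close> leaves \<open>P\<close> and the measure with \<open>Q\<close>-density
  \<open>1 / L\<close> within a factor \<open>r\<close> of each other, for every \<open>r > 1\<close>; both values are finite, so they agree.
\<close>

lemma expectation_inverse_limsup: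
  "emeasure P {\<omega> \<in> space P. L \<omega> > 0} = (\<integral>\<^sup>+\<omega>. 1 / L \<omega> \<partial>Q)"
proof -
  have [measurable]: "L \<in> borel_measurable P" "L \<in> borel_measurable Q"
    using L_measurable sets_eq by (simp_all cong: measurable_cong_sets)
  define mid where "mid = {\<omega> \<in> space P. 0 < L \<omega> \<and> L \<omega> < \<infinity>}"
  have mid_P: "mid \<in> sets P"
    unfolding mid_def by measurable
  then have mid_Q: "mid \<in> sets Q"
    using sets_eq by simp
  let ?N = "density Q (\<lambda>\<omega>. 1 / L \<omega>)"
  have band_sets: "geometric_band r k \<in> sets P" for r k
    using eventually_below_sets frequently_above_sets by (simp add: geometric_band_def)
  have bounds: "emeasure ?N mid \<le> ennreal r * emeasure P mid"
    "ennreal (1 / r) * emeasure P mid \<le> emeasure ?N mid" if r: "1 < r" for r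
  proof -
    have ratio: "r powr (k + 1) / r powr k = r" "r powr k / r powr (k + 1) = 1 / r" for k :: int
      using r by (auto simp: powr_add)
    have le: "r powr k \<le> r powr (k + 1)" for k :: int
      using r by (intro powr_mono) auto
    have "emeasure ?N (\<Union>k. geometric_band r k) \<le> emeasure (scale_measure (ennreal r) P) (\<Union>k. geometric_band r k)"
    proof (rule emeasure_le_UN_disjoint)
      show "emeasure ?N (geometric_band r k) \<le> emeasure (scale_measure (ennreal r) P) (geometric_band r k)" for k
        using inverse_limsup_on_band(1)[OF _ le, of k] r ratio by (simp add: geometric_band_def)
    qed (use band_sets sets_eq disjoint_geometric_bands[OF r] in auto)
    then show "emeasure ?N mid \<le> ennreal r * emeasure P mid"
      using UN_geometric_bands[OF r] by (simp add: mid_def)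
    have "emeasure (scale_measure (ennreal (1 / r)) P) (\<Union>k. geometric_band r k) \<le> emeasure ?N (\<Union>k. geometric_band r k)"
    proof (rule emeasure_le_UN_disjoint)
      show "emeasure (scale_measure (ennreal (1 / r)) P) (geometric_band r k) \<le> emeasure ?N (geometric_band r k)" for k
        using inverse_limsup_on_band(2)[OF _ le, of k] r ratio by (simp add: geometric_band_def)
    qed (use band_sets sets_eq disjoint_geometric_bands[OF r] in auto)
    then show "ennreal (1 / r) * emeasure P mid \<le> emeasure ?N mid"
      using UN_geometric_bands[OF r] by (simp add: mid_def)
  qed
  obtain p where p: "emeasure P mid = ennreal p" "0 \<le> p"
    using finite_measure.emeasure_finite[OF finite_P, of mid] by (cases "emeasure P mid") auto
  \<comment> \<open>Any ratio serves to see that the integral of \<open>1 / L\<close> is finite.\<close>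
  have "emeasure ?N mid \<le> ennreal (2 * p)"
    using bounds(1)[of 2] p by (simp add: ennreal_mult)
  then obtain n where n: "emeasure ?N mid = ennreal n" "0 \<le> n"
    by (cases "emeasure ?N mid") (auto simp: top_unique)
  \<comment> \<open>The bounds for the ratio \<open>r = 1 / z\<close>.\<close>
  have scaled: "z * n \<le> p \<and> z * p \<le> n" if z: "0 < z" "z < 1" for z
  proof -
    have "1 < 1 / z"
      using z by simp
    have mult: "ennreal (1 / z * p) = ennreal (1 / z) * ennreal p" "ennreal (z * p) = ennreal z * ennreal p"
      by (rule ennreal_mult; use z p in simp)+
    have "ennreal n \<le> ennreal (1 / z * p)"
      using bounds(1)[OF \<open>1 < 1 / z\<close>] unfolding mult p(1) n(1) .
    moreover have "ennreal (z * p) \<le> ennreal n"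
      using bounds(2)[OF \<open>1 < 1 / z\<close>] unfolding mult p(1) n(1) by simp
    ultimately have "n \<le> 1 / z * p" "z * p \<le> n"
      using p n z by (subst (asm) ennreal_le_iff; simp)+
    then show ?thesis
      using z by (simp add: field_simps)
  qed
  have "n \<le> p"
    by (rule field_le_mult_one_interval) (use scaled in blast)
  moreover have "p \<le> n"
    by (rule field_le_mult_one_interval) (use scaled in blast)
  ultimately have "n = p"
    by simp
  then have mid: "emeasure P mid = emeasure ?N mid"
    using p n by simp
  have "emeasure P {\<omega> \<in> space P. L \<omega> > 0} = emeasure P mid"
    using P_limsup_infinite mid_P
    by (intro emeasure_eq_AE) (auto simp: mid_def less_top elim!: eventually_mono)
  also have "\<dots> = emeasure ?N mid"
    by (rule mid)
  also have "\<dots> = (\<integral>\<^sup>+\<omega>. 1 / L \<omega> * indicator mid \<omega> \<partial>Q)"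
    using mid_Q by (intro emeasure_density) auto
  also have "\<dots> = (\<integral>\<^sup>+\<omega>. 1 / L \<omega> \<partial>Q)"
  proof (rule nn_integral_cong_AE)
    show "AE \<omega> in Q. 1 / L \<omega> * indicator mid \<omega> = 1 / L \<omega>"
      using Q_limsup_zero AE_space
    proof eventually_elim
      case (elim \<omega>)
      then show ?case
        using space_eq by (cases "L \<omega> = \<infinity>") (auto simp: mid_def less_top zero_less_iff_neq_zero)
    qed
  qed
  finally show ?thesis .
qed

end

theorem lemma5:
  fixes P Q :: "'a measure" and T :: "real set"
    and F :: "real \<Rightarrow> 'a measure" and Z :: "real \<Rightarrow> 'a \<Rightarrow> real"
  assumes time: "T = {0..} \<or> T = \<nat>"
    and prob_P: "prob_space P" and prob_Q: "prob_space Q" and sets_eq: "sets Q = sets P"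
    and filtration: "filtration_on P T F"
    and cadlag: "\<And>\<omega>. \<omega> \<in> space P \<Longrightarrow> cadlag_on T (\<lambda>t. Z t \<omega>)"
    and adapted: "adapted_on T F Z"
    and nonneg: "\<And>t \<omega>. t \<in> T \<Longrightarrow> \<omega> \<in> space P \<Longrightarrow> 0 \<le> Z t \<omega>"
    and density: "density_process P Q T F Z"
  shows "(\<forall>t\<in>T.
           {\<omega> \<in> space P. extinction_time T Z \<omega> > ereal t} \<in> sets (completion P) \<and>
           emeasure (completion P) {\<omega> \<in> space P. extinction_time T Z \<omega> > ereal t}
             = emeasure P {\<omega> \<in> space P. Z t \<omega> > 0} \<and>
           emeasure P {\<omega> \<in> space P. Z t \<omega> > 0} = (\<integral>\<^sup>+\<omega>. 1 / ennreal (Z t \<omega>) \<partial>Q)) \<and>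
         emeasure P {\<omega> \<in> space P. limsup_process T Z \<omega> > 0}
           = (\<integral>\<^sup>+\<omega>. 1 / limsup_process T Z \<omega> \<partial>Q)"
proof -
  interpret filtered_density P Q T F Z
    by (rule filtered_density.intro) fact+
  show ?thesis
    by (intro conjI ballI)
       (simp_all only: extinction_time_law expectation_inverse_density expectation_inverse_limsup)
qed

end
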